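(* Let $g$ be a complex Lie algebra with universal enveloping algebra $U(g)$, let $V=\mathbb{C}\oplus g$, regarded as a subspace of $U(g)$ with $1\in\mathbb{C}$ the unit of $U(g)$, and let $\Psi:V\otimes V\to V\otimes V$ be the braiding defined by $$\Psi(1\otimes 1)=1\otimes 1,\quad \Psi(1\otimes\xi)=\xi\otimes 1,\quad \Psi(\xi\otimes 1)=1\otimes\xi,\quad \Psi(\xi\otimes\eta)=\eta\otimes\xi+[\xi,\eta]\otimes 1\qquad \forall\,\xi,\eta\in g.$$ Then $\Psi$ extends to a braiding $\Psi:U(g)\otimes U(g)\to U(g)\otimes U(g)$, and $U(g)$ is braided commutative with respect to it, i.e. $\cdot\circ\Psi=\cdot$ as maps $U(g)\otimes U(g)\to U(g)$, where $\cdot$ is the product of $U(g)$.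
   Context: A braiding on a vector space $W$ is a linear map $\Psi:W\otimes W\to W\otimes W$ such that $\Psi_{23}\circ\Psi_{12}\circ\Psi_{23}=\Psi_{12}\circ\Psi_{23}\circ\Psi_{12}$ on $W\otimes W\otimes W$, where $\Psi_{12}=\Psi\otimes\mathrm{id}$ and $\Psi_{23}=\mathrm{id}\otimes\Psi$. *)

theory Defs
  imports Complex_Main "HOL-Library.Poly_Mapping" "HOL-Library.Product_Plus"
begin

section \<open>Complex vector spaces, algebras and Lie algebras\<close>

class complex_vector = ab_group_add +
  fixes scaleC :: "complex \<Rightarrow> 'a \<Rightarrow> 'a"  (infixr \<open>*\<^sub>C\<close> 75)
  assumes scaleC_add_right: "c *\<^sub>C (x + y) = c *\<^sub>C x + c *\<^sub>C y"
    and scaleC_add_left: "(c + d) *\<^sub>C x = c *\<^sub>C x + d *\<^sub>C x"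
    and scaleC_scaleC: "c *\<^sub>C d *\<^sub>C x = (c * d) *\<^sub>C x"
    and scaleC_one: "1 *\<^sub>C x = x"

global_interpretation complex_vector:
  vector_space "scaleC :: complex \<Rightarrow> 'a \<Rightarrow> 'a::complex_vector"
  by standard (simp_all add: scaleC_add_right scaleC_add_left scaleC_scaleC scaleC_one)

abbreviation clinear :: "('a::complex_vector \<Rightarrow> 'b::complex_vector) \<Rightarrow> bool"
  where "clinear \<equiv> Vector_Spaces.linear scaleC scaleC"

definition cbilinear ::
    "('a::complex_vector \<Rightarrow> 'b::complex_vector \<Rightarrow> 'c::complex_vector) \<Rightarrow> bool"
  where "cbilinear B \<longleftrightarrow> (\<forall>a. clinear (B a)) \<and> (\<forall>b. clinear (\<lambda>a. B a b))"

class complex_algebra = complex_vector + ring_1 +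
  assumes scaleC_mult_left: "(c *\<^sub>C x) * y = c *\<^sub>C (x * y)"
    and scaleC_mult_right: "x * (c *\<^sub>C y) = c *\<^sub>C (x * y)"

class complex_lie_algebra = complex_vector +
  fixes bracket :: "'a \<Rightarrow> 'a \<Rightarrow> 'a"
  assumes bracket_add_left: "bracket (x + y) z = bracket x z + bracket y z"
    and bracket_add_right: "bracket x (y + z) = bracket x y + bracket x z"
    and bracket_scaleC_left: "bracket (c *\<^sub>C x) y = c *\<^sub>C bracket x y"
    and bracket_scaleC_right: "bracket x (c *\<^sub>C y) = c *\<^sub>C bracket x y"
    and bracket_self: "bracket x x = 0"
    and jacobi: "bracket x (bracket y z) + bracket y (bracket z x) + bracket z (bracket x y) = 0"

lemma clinearI:
  assumes "\<And>x y. f (x + y) = f x + f y" "\<And>c x. f (c *\<^sub>C x) = c *\<^sub>C f x"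
  shows "clinear f"
  using assms
  by (simp add: Vector_Spaces.linear_iff complex_vector.vector_space_axioms)

lemma
  assumes "clinear f"
  shows clinear_add: "f (x + y) = f x + f y"
    and clinear_scaleC: "f (c *\<^sub>C x) = c *\<^sub>C f x"
    and clinear_zero: "f 0 = 0"
    and clinear_diff: "f (x - y) = f x - f y"
    and clinear_sum: "f (sum g A) = (\<Sum>a\<in>A. f (g a))"
proof -
  interpret l: Vector_Spaces.linear scaleC scaleC f by fact
  show "f (x + y) = f x + f y" "f (c *\<^sub>C x) = c *\<^sub>C f x" "f 0 = 0" "f (x - y) = f x - f y"
    "f (sum g A) = (\<Sum>a\<in>A. f (g a))"
    by (rule l.add l.scale l.zero l.diff l.sum)+
qed

lemma clinear_id: "clinear (\<lambda>x. x)"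
  by (rule clinearI) auto

lemma clinear_compose: "clinear f \<Longrightarrow> clinear g \<Longrightarrow> clinear (\<lambda>x. f (g x))"
  by (rule clinearI) (auto simp: clinear_add clinear_scaleC)

lemma clinear_plus: "clinear f \<Longrightarrow> clinear g \<Longrightarrow> clinear (\<lambda>x. f x + g x)"
  by (rule clinearI) (auto simp: clinear_add clinear_scaleC scaleC_add_right algebra_simps)

lemma clinear_scale: "clinear f \<Longrightarrow> clinear (\<lambda>x. c *\<^sub>C f x)"
  by (rule clinearI)
    (auto simp: clinear_add clinear_scaleC scaleC_add_right scaleC_scaleC mult.commute)

lemma cbilinearI:
  assumes "\<And>a. clinear (B a)" "\<And>b. clinear (\<lambda>a. B a b)"
  shows "cbilinear B"
  using assms by (auto simp: cbilinear_def)

lemma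
  assumes "cbilinear B"
  shows cbilinear_left: "clinear (\<lambda>a. B a b)" and cbilinear_right: "clinear (B a)"
  using assms by (auto simp: cbilinear_def)

instantiation complex :: complex_algebra
begin

definition scaleC_complex :: "complex \<Rightarrow> complex \<Rightarrow> complex"
  where "scaleC_complex = (*)"

instance
  by standard (auto simp: scaleC_complex_def algebra_simps)

end

instantiation prod :: (complex_vector, complex_vector) complex_vector
begin

definition scaleC_prod :: "complex \<Rightarrow> 'a \<times> 'b \<Rightarrow> 'a \<times> 'b"
  where "scaleC_prod c p = (c *\<^sub>C fst p, c *\<^sub>C snd p)"

instance
  by standard (auto simp: scaleC_prod_def scaleC_add_right scaleC_add_left scaleC_scaleC scaleC_one
      prod_eq_iff)

end

abbreviation (input) single where "single \<equiv> Poly_Mapping.single"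
abbreviation (input) lookup where "lookup \<equiv> Poly_Mapping.lookup"
abbreviation (input) keys where "keys \<equiv> Poly_Mapping.keys"

instantiation poly_mapping :: (type, complex_vector) complex_vector
begin

lift_definition scaleC_poly_mapping :: "complex \<Rightarrow> ('a \<Rightarrow>\<^sub>0 'b) \<Rightarrow> 'a \<Rightarrow>\<^sub>0 'b"
  is "\<lambda>c f k. c *\<^sub>C f k"
  by (erule rev_finite_subset) auto

instance
  by standard
    (transfer, simp add: scaleC_add_right scaleC_add_left scaleC_scaleC scaleC_one)+

end

lemma lookup_scaleC: "lookup (c *\<^sub>C p) k = c *\<^sub>C lookup p k"
  by transfer simp

lemma scaleC_single: "c *\<^sub>C single k v = single k (c *\<^sub>C v)"
  by (rule poly_mapping_eqI) (simp add: lookup_scaleC lookup_single when_def)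

lemma poly_mapping_sum_single: "p = (\<Sum>k\<in>keys p. single k (lookup p k))"
proof (rule poly_mapping_eqI)
  fix k
  have "lookup (\<Sum>k\<in>keys p. single k (lookup p k)) k
      = (\<Sum>k'\<in>keys p. if k' = k then lookup p k' else 0)"
    by (simp add: lookup_sum lookup_single when_def)
  then show "lookup p k = lookup (\<Sum>k\<in>keys p. single k (lookup p k)) k"
    by (simp add: in_keys_iff)
qed

instance poly_mapping :: (monoid_add, complex_algebra) complex_algebra
proof
  fix c and p q :: "'a \<Rightarrow>\<^sub>0 'b"
  have scale: "c *\<^sub>C r = single 0 (c *\<^sub>C 1) * r" for r :: "'a \<Rightarrow>\<^sub>0 'b"
  proof -
    have "c *\<^sub>C r = (\<Sum>k\<in>keys r. c *\<^sub>C single k (lookup r k))"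
      by (subst poly_mapping_sum_single[of r]) (rule complex_vector.scale_sum_right)
    also have "\<dots> = (\<Sum>k\<in>keys r. single 0 (c *\<^sub>C 1) * single k (lookup r k))"
      by (simp add: scaleC_single mult_single scaleC_mult_left)
    also have "\<dots> = single 0 (c *\<^sub>C 1) * r"
      by (simp only: poly_mapping_sum_single[symmetric] flip: sum_distrib_left)
    finally show ?thesis .
  qed
  have scale': "c *\<^sub>C r = r * single 0 (c *\<^sub>C 1)" for r :: "'a \<Rightarrow>\<^sub>0 'b"
  proof -
    have "c *\<^sub>C r = (\<Sum>k\<in>keys r. c *\<^sub>C single k (lookup r k))"
      by (subst poly_mapping_sum_single[of r]) (rule complex_vector.scale_sum_right)
    also have "\<dots> = (\<Sum>k\<in>keys r. single k (lookup r k) * single 0 (c *\<^sub>C 1))"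
      by (simp add: scaleC_single mult_single scaleC_mult_right)
    also have "\<dots> = r * single 0 (c *\<^sub>C 1)"
      by (simp only: poly_mapping_sum_single[symmetric] flip: sum_distrib_right)
    finally show ?thesis .
  qed
  show "(c *\<^sub>C p) * q = c *\<^sub>C (p * q)"
    unfolding scale by (simp add: mult.assoc)
  show "p * (c *\<^sub>C q) = c *\<^sub>C (p * q)"
    unfolding scale' by (simp add: mult.assoc)
qed

definition free_extend :: "('k \<Rightarrow> 'a::complex_vector) \<Rightarrow> ('k \<Rightarrow>\<^sub>0 complex) \<Rightarrow> 'a"
  where "free_extend f p = (\<Sum>k\<in>keys p. lookup p k *\<^sub>C f k)"

lemma free_extend_superset:
  assumes "finite K" "keys p \<subseteq> K"
  shows "free_extend f p = (\<Sum>k\<in>K. lookup p k *\<^sub>C f k)"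
  unfolding free_extend_def
  by (rule sum.mono_neutral_left) (use assms in \<open>auto simp: in_keys_iff\<close>)

lemma clinear_free_extend: "clinear (free_extend f)"
proof (rule clinearI)
  fix p q :: "'a \<Rightarrow>\<^sub>0 complex" and c
  let ?K = "keys p \<union> keys q"
  have K: "keys (p + q) \<subseteq> ?K"
    by (rule keys_add)
  show "free_extend f (p + q) = free_extend f p + free_extend f q"
    by (simp add: free_extend_superset[of ?K] K lookup_add scaleC_add_left sum.distrib)
  have "keys (c *\<^sub>C p) \<subseteq> keys p"
    by (auto simp: in_keys_iff lookup_scaleC)
  then show "free_extend f (c *\<^sub>C p) = c *\<^sub>C free_extend f p"
    by (simp add: free_extend_superset[of "keys p"] lookup_scaleC complex_vector.scale_sum_right
        scaleC_scaleC scaleC_complex_def)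
qed

lemma free_extend_single: "free_extend f (single k c) = c *\<^sub>C f k"
  by (simp add: free_extend_superset[of "{k}"])

lemma clinear_poly_mapping_eqI:
  assumes "clinear F" "clinear G" "\<And>k. F (single k 1) = G (single k (1::complex))"
  shows "F p = G p"
proof -
  have "p = (\<Sum>k\<in>keys p. lookup p k *\<^sub>C single k 1)"
    by (subst poly_mapping_sum_single) (simp add: scaleC_single scaleC_complex_def)
  then obtain A h where p: "p = (\<Sum>k\<in>A. h k *\<^sub>C single k 1)"
    by blast
  show ?thesis
    unfolding p using assms by (simp add: clinear_sum clinear_scaleC)
qed

lemma clinear_vanish_span:
  assumes "clinear F" "\<And>r. r \<in> S \<Longrightarrow> F r = 0" "x \<in> complex_vector.span S"
  shows "F x = 0"
  using assms(3)
  by (induction rule: complex_vector.span_induct_alt)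
    (simp_all add: assms clinear_zero clinear_add clinear_scaleC)


section \<open>Tensor products over the complex numbers\<close>

text \<open>The free vector space on \<^typ>\<open>'a \<times> 'b\<close> modulo the bilinearity relations.\<close>

definition tensor_relations ::
    "(('a::complex_vector \<times> 'b::complex_vector) \<Rightarrow>\<^sub>0 complex) set"
  where "tensor_relations =
    {single (a + a', b) 1 - single (a, b) 1 - single (a', b) 1 | a a' b. True} \<union>
    {single (a, b + b') 1 - single (a, b) 1 - single (a, b') 1 | a b b'. True} \<union>
    {single (c *\<^sub>C a, b) 1 - c *\<^sub>C single (a, b) 1 | c a b. True} \<union>
    {single (a, c *\<^sub>C b) 1 - c *\<^sub>C single (a, b) 1 | c a b. True}"

definition tensor_equiv ::
    "(('a::complex_vector \<times> 'b::complex_vector) \<Rightarrow>\<^sub>0 complex) \<Rightarrow> ('a \<times> 'b \<Rightarrow>\<^sub>0 complex) \<Rightarrow> bool"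
  where "tensor_equiv p q \<longleftrightarrow> p - q \<in> complex_vector.span tensor_relations"

lemma span_diff_equivp:
  "equivp (\<lambda>p q :: 'a::complex_vector. p - q \<in> complex_vector.span S)"
proof (rule equivpI)
  show "reflp (\<lambda>p q. p - q \<in> complex_vector.span S)"
    by (auto intro!: reflpI complex_vector.span_zero)
  show "symp (\<lambda>p q. p - q \<in> complex_vector.span S)"
    by (rule sympI) (metis complex_vector.span_neg minus_diff_eq)
  show "transp (\<lambda>p q. p - q \<in> complex_vector.span S)"
  proof (rule transpI)
    fix p q r
    assume "p - q \<in> complex_vector.span S" "q - r \<in> complex_vector.span S"
    then have "(p - q) + (q - r) \<in> complex_vector.span S"
      by (rule complex_vector.span_add)
    then show "p - r \<in> complex_vector.span S" by simp
  qed
qed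

lemma span_diff_cong:
  fixes p q :: "'a::complex_vector"
  assumes "p - p' \<in> complex_vector.span S"
  shows span_diff_cong_minus: "- p - - p' \<in> complex_vector.span S"
    and span_diff_cong_scaleC: "c *\<^sub>C p - c *\<^sub>C p' \<in> complex_vector.span S"
    and span_diff_cong_add: "q - q' \<in> complex_vector.span S
      \<Longrightarrow> (p + q) - (p' + q') \<in> complex_vector.span S"
    and span_diff_cong_diff: "q - q' \<in> complex_vector.span S
      \<Longrightarrow> (p - q) - (p' - q') \<in> complex_vector.span S"
proof -
  show "- p - - p' \<in> complex_vector.span S"
    using complex_vector.span_neg[OF assms] by simp
  show "c *\<^sub>C p - c *\<^sub>C p' \<in> complex_vector.span S"
    using complex_vector.span_scale[OF assms, of c]
    by (simp add: complex_vector.scale_right_diff_distrib)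
  assume q: "q - q' \<in> complex_vector.span S"
  show "(p + q) - (p' + q') \<in> complex_vector.span S"
    using complex_vector.span_add[OF assms q] by (simp add: algebra_simps)
  show "(p - q) - (p' - q') \<in> complex_vector.span S"
    using complex_vector.span_diff[OF assms q] by (simp add: algebra_simps)
qed

quotient_type (overloaded) ('a, 'b) tensor (infixl \<open>\<otimes>\<close> 70) =
  "('a::complex_vector \<times> 'b::complex_vector) \<Rightarrow>\<^sub>0 complex" / tensor_equiv
  unfolding tensor_equiv_def by (rule span_diff_equivp)

instantiation tensor :: (complex_vector, complex_vector) complex_vector
begin

lift_definition zero_tensor :: "'a \<otimes> 'b" is 0 .

lift_definition plus_tensor :: "'a \<otimes> 'b \<Rightarrow> 'a \<otimes> 'b \<Rightarrow> 'a \<otimes> 'b" is "(+)"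
  unfolding tensor_equiv_def by (rule span_diff_cong_add)

lift_definition minus_tensor :: "'a \<otimes> 'b \<Rightarrow> 'a \<otimes> 'b \<Rightarrow> 'a \<otimes> 'b" is "(-)"
  unfolding tensor_equiv_def by (rule span_diff_cong_diff)

lift_definition uminus_tensor :: "'a \<otimes> 'b \<Rightarrow> 'a \<otimes> 'b" is uminus
  unfolding tensor_equiv_def by (rule span_diff_cong_minus)

lift_definition scaleC_tensor :: "complex \<Rightarrow> 'a \<otimes> 'b \<Rightarrow> 'a \<otimes> 'b" is scaleC
  unfolding tensor_equiv_def by (rule span_diff_cong_scaleC)

instance
  by standard
    (transfer, simp add: tensor_equiv_def complex_vector.span_zero scaleC_add_right
      scaleC_add_left scaleC_scaleC scaleC_one add.assoc add.commute)+

end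

lift_definition pure_tensor :: "'a::complex_vector \<Rightarrow> 'b::complex_vector \<Rightarrow> 'a \<otimes> 'b"
    (infixl \<open>\<otimes>\<close> 70)
  is "\<lambda>a b. single (a, b) 1" .

text \<open>The linear map induced by a bilinear map. The value does not depend on the chosen
  representative when \<open>B\<close> is bilinear; for other \<open>B\<close> it is meaningless.\<close>

definition tensor_lift ::
    "('a::complex_vector \<Rightarrow> 'b::complex_vector \<Rightarrow> 'c::complex_vector) \<Rightarrow> 'a \<otimes> 'b \<Rightarrow> 'c"
  where "tensor_lift B t = free_extend (case_prod B) (rep_tensor t)"

lemma tensor_relations_members:
  "single (a + a', b) 1 - single (a, b) 1 - single (a', b) 1 \<in> tensor_relations"
  "single (a, b + b') 1 - single (a, b) 1 - single (a, b') 1 \<in> tensor_relations"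
  "single (c *\<^sub>C a, b) 1 - c *\<^sub>C single (a, b) 1 \<in> tensor_relations"
  "single (a, c *\<^sub>C b) 1 - c *\<^sub>C single (a, b) 1 \<in> tensor_relations"
  unfolding tensor_relations_def by blast+

lemma cbilinear_pure_tensor:
  "cbilinear (pure_tensor :: 'a::complex_vector \<Rightarrow> 'b::complex_vector \<Rightarrow> 'a \<otimes> 'b)"
proof (intro cbilinearI clinearI)
  fix a a' :: 'a and b b' :: 'b and c
  show "(a + a') \<otimes> b = a \<otimes> b + a' \<otimes> b" "a \<otimes> (b + b') = a \<otimes> b + a \<otimes> b'"
    "(c *\<^sub>C a) \<otimes> b = c *\<^sub>C (a \<otimes> b)" "a \<otimes> (c *\<^sub>C b) = c *\<^sub>C (a \<otimes> b)"
    by (transfer, unfold tensor_equiv_def diff_diff_eq[symmetric],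
      rule complex_vector.span_base[OF tensor_relations_members(1)]
        complex_vector.span_base[OF tensor_relations_members(2)]
        complex_vector.span_base[OF tensor_relations_members(3)]
        complex_vector.span_base[OF tensor_relations_members(4)])+
qed

lemma tensor_lift_abs:
  assumes "cbilinear B"
  shows "tensor_lift B (abs_tensor p) = free_extend (case_prod B) p"
proof -
  let ?F = "free_extend (case_prod B)"
  have "tensor_equiv (rep_tensor (abs_tensor p)) p"
    using Quotient3_tensor by (metis Quotient3_abs_rep Quotient3_rel tensor.abs_eq_iff)
  then have "rep_tensor (abs_tensor p) - p \<in> complex_vector.span tensor_relations"
    by (simp add: tensor_equiv_def)
  moreover have "?F r = 0" if "r \<in> tensor_relations" for r
    using that unfolding tensor_relations_def
    by (auto simp: clinear_diff[OF clinear_free_extend] clinear_scaleC[OF clinear_free_extend]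
        free_extend_single scaleC_one clinear_add[OF cbilinear_left[OF assms]]
        clinear_add[OF cbilinear_right[OF assms]] clinear_scaleC[OF cbilinear_left[OF assms]]
        clinear_scaleC[OF cbilinear_right[OF assms]])
  ultimately have "?F (rep_tensor (abs_tensor p) - p) = 0"
    by (rule clinear_vanish_span[OF clinear_free_extend, rotated])
  then show ?thesis
    by (simp add: tensor_lift_def clinear_diff[OF clinear_free_extend])
qed

lemma clinear_abs_tensor: "clinear abs_tensor"
  by (rule clinearI) (simp_all add: plus_tensor.abs_eq scaleC_tensor.abs_eq)

lemma clinear_tensor_lift:
  assumes "cbilinear B"
  shows "clinear (tensor_lift B)"
proof (rule clinearI)
  fix s t :: "'a \<otimes> 'b" and c
  obtain p q where st: "s = abs_tensor p" "t = abs_tensor q"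
    by (metis Quotient3_abs_rep Quotient3_tensor)
  show "tensor_lift B (s + t) = tensor_lift B s + tensor_lift B t"
    unfolding st clinear_add[OF clinear_abs_tensor, symmetric] tensor_lift_abs[OF assms]
    by (rule clinear_add[OF clinear_free_extend])
  show "tensor_lift B (c *\<^sub>C s) = c *\<^sub>C tensor_lift B s"
    unfolding st clinear_scaleC[OF clinear_abs_tensor, symmetric] tensor_lift_abs[OF assms]
    by (rule clinear_scaleC[OF clinear_free_extend])
qed

lemma tensor_lift_pure:
  assumes "cbilinear B"
  shows "tensor_lift B (a \<otimes> b) = B a b"
  by (simp add: pure_tensor.abs_eq tensor_lift_abs[OF assms] free_extend_single scaleC_one)

lemma clinear_tensor_eqI:
  assumes "clinear F" "clinear G" "\<And>a b. F (a \<otimes> b) = G (a \<otimes> b)"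
  shows "F t = G t"
proof -
  obtain p where t: "t = abs_tensor p"
    by (metis Quotient3_abs_rep Quotient3_tensor)
  have "F (abs_tensor p) = G (abs_tensor p)"
  proof (rule clinear_poly_mapping_eqI)
    show "clinear (\<lambda>p. F (abs_tensor p))" "clinear (\<lambda>p. G (abs_tensor p))"
      by (rule clinear_compose[OF assms(1) clinear_abs_tensor]
          clinear_compose[OF assms(2) clinear_abs_tensor])+
    show "F (abs_tensor (single k 1)) = G (abs_tensor (single k 1))" for k
      using assms(3) by (cases k) (simp add: pure_tensor.abs_eq)
  qed
  then show ?thesis by (simp add: t)
qed

definition tensor_map :: "('a::complex_vector \<Rightarrow> 'c::complex_vector)
    \<Rightarrow> ('b::complex_vector \<Rightarrow> 'd::complex_vector) \<Rightarrow> 'a \<otimes> 'b \<Rightarrow> 'c \<otimes> 'd"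
  where "tensor_map f g = tensor_lift (\<lambda>a b. f a \<otimes> g b)"

definition tensor_assoc ::
    "('a::complex_vector \<otimes> 'b::complex_vector) \<otimes> 'c::complex_vector \<Rightarrow> 'a \<otimes> ('b \<otimes> 'c)"
  where "tensor_assoc = tensor_lift (\<lambda>t c. tensor_lift (\<lambda>a b. a \<otimes> (b \<otimes> c)) t)"

definition tensor_assoc_inv ::
    "'a::complex_vector \<otimes> ('b::complex_vector \<otimes> 'c::complex_vector) \<Rightarrow> ('a \<otimes> 'b) \<otimes> 'c"
  where "tensor_assoc_inv = tensor_lift (\<lambda>a. tensor_lift (\<lambda>b c. (a \<otimes> b) \<otimes> c))"

lemmas clinear_pure_left = cbilinear_left[OF cbilinear_pure_tensor]
lemmas clinear_pure_right = cbilinear_right[OF cbilinear_pure_tensor]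

lemma cbilinear_tensor_map:
  assumes "clinear f" "clinear g"
  shows "cbilinear (\<lambda>a b. f a \<otimes> g b)"
  by (rule cbilinearI clinear_compose[OF clinear_pure_left assms(1)]
      clinear_compose[OF clinear_pure_right assms(2)])+

lemma
  assumes "clinear f" "clinear g"
  shows clinear_tensor_map: "clinear (tensor_map f g)"
    and tensor_map_pure: "tensor_map f g (a \<otimes> b) = f a \<otimes> g b"
  unfolding tensor_map_def
  by (intro clinear_tensor_lift tensor_lift_pure cbilinear_tensor_map assms)+

lemma clinear_tensor_lift_param:
  assumes "\<And>a b. clinear (\<lambda>c. B c a b)" "\<And>c. cbilinear (B c)"
  shows "clinear (\<lambda>c. tensor_lift (B c) t)"
proof (rule clinearI)
  fix c d and k
  show "tensor_lift (B (c + d)) t = tensor_lift (B c) t + tensor_lift (B d) t"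
    by (rule clinear_tensor_eqI)
      (rule clinear_tensor_lift[OF assms(2)] clinear_plus[OF clinear_tensor_lift[OF assms(2)] clinear_tensor_lift[OF assms(2)]]
        | simp only: tensor_lift_pure[OF assms(2)], simp only: clinear_add[OF assms(1)])+
  show "tensor_lift (B (k *\<^sub>C c)) t = k *\<^sub>C tensor_lift (B c) t"
    by (rule clinear_tensor_eqI)
      (rule clinear_tensor_lift[OF assms(2)] clinear_scale[OF clinear_tensor_lift[OF assms(2)]]
        | simp only: tensor_lift_pure[OF assms(2)], simp only: clinear_scaleC[OF assms(1)])+
qed

lemma cbilinear_tensor_assoc_aux:
  "cbilinear (\<lambda>a b. a \<otimes> (b \<otimes> c))" "cbilinear (\<lambda>b c. (a \<otimes> b) \<otimes> c)"
  "clinear (\<lambda>c. a \<otimes> (b \<otimes> c))" "clinear (\<lambda>a. (a \<otimes> b) \<otimes> c)"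
  by (rule cbilinearI clinear_pure_left clinear_compose[OF clinear_pure_right clinear_pure_left]
      clinear_compose[OF clinear_pure_right clinear_pure_right] clinear_pure_right
      clinear_compose[OF clinear_pure_left clinear_pure_left]
      clinear_compose[OF clinear_pure_left clinear_pure_right])+

lemma cbilinear_tensor_assoc:
  "cbilinear (\<lambda>t c. tensor_lift (\<lambda>a b. a \<otimes> (b \<otimes> c)) t)"
  "cbilinear (\<lambda>a. tensor_lift (\<lambda>b c. (a \<otimes> b) \<otimes> c))"
  by (rule cbilinearI clinear_tensor_lift clinear_tensor_lift_param cbilinear_tensor_assoc_aux)+

lemma
  shows clinear_tensor_assoc: "clinear tensor_assoc"
    and clinear_tensor_assoc_inv: "clinear tensor_assoc_inv"
    and tensor_assoc_pure: "tensor_assoc ((a \<otimes> b) \<otimes> c) = a \<otimes> (b \<otimes> c)"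
    and tensor_assoc_inv_pure: "tensor_assoc_inv (a \<otimes> (b \<otimes> c)) = (a \<otimes> b) \<otimes> c"
  unfolding tensor_assoc_def tensor_assoc_inv_def
  by (simp_all add: clinear_tensor_lift tensor_lift_pure cbilinear_tensor_assoc
      cbilinear_tensor_assoc_aux)


section \<open>Braidings\<close>

definition braid12 :: "('a::complex_vector \<otimes> 'a \<Rightarrow> 'a \<otimes> 'a) \<Rightarrow> ('a \<otimes> 'a) \<otimes> 'a \<Rightarrow> ('a \<otimes> 'a) \<otimes> 'a"
  where "braid12 \<Psi> = tensor_map \<Psi> id"

definition braid23 :: "('a::complex_vector \<otimes> 'a \<Rightarrow> 'a \<otimes> 'a) \<Rightarrow> ('a \<otimes> 'a) \<otimes> 'a \<Rightarrow> ('a \<otimes> 'a) \<otimes> 'a"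
  where "braid23 \<Psi> = tensor_assoc_inv \<circ> tensor_map id \<Psi> \<circ> tensor_assoc"

text \<open>Invertibility is not part of the definition. The triple tensor product is
  bracketed to the left, hence the associators in \<^const>\<open>braid23\<close>.\<close>

definition braiding :: "('a::complex_vector \<otimes> 'a \<Rightarrow> 'a \<otimes> 'a) \<Rightarrow> bool"
  where "braiding \<Psi> \<longleftrightarrow> clinear \<Psi> \<and>
    braid23 \<Psi> \<circ> braid12 \<Psi> \<circ> braid23 \<Psi> = braid12 \<Psi> \<circ> braid23 \<Psi> \<circ> braid12 \<Psi>"

definition algebra_mult :: "'a::complex_algebra \<otimes> 'a \<Rightarrow> 'a"
  where "algebra_mult = tensor_lift (*)"

lemma cbilinear_times: "cbilinear ((*) :: 'a::complex_algebra \<Rightarrow> 'a \<Rightarrow> 'a)"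
  by (intro cbilinearI clinearI)
    (simp_all add: distrib_left distrib_right scaleC_mult_left scaleC_mult_right)

lemma algebra_mult_pure: "algebra_mult (a \<otimes> b) = a * b"
  unfolding algebra_mult_def by (rule tensor_lift_pure[OF cbilinear_times])


section \<open>The universal enveloping algebra\<close>

datatype 'a free_monoid = Word (letters: "'a list")

instantiation free_monoid :: (type) monoid_add
begin

definition zero_free_monoid :: "'a free_monoid"
  where "0 = Word []"

definition plus_free_monoid :: "'a free_monoid \<Rightarrow> 'a free_monoid \<Rightarrow> 'a free_monoid"
  where "v + w = Word (letters v @ letters w)"

instance
  by standard (simp_all add: zero_free_monoid_def plus_free_monoid_def)

end

text \<open>The monoid algebra of the free monoid on \<open>'a\<close>, i.e. noncommutative polynomials.\<close>

type_synonym 'a free_algebra = "'a free_monoid \<Rightarrow>\<^sub>0 complex"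

definition gen :: "'a \<Rightarrow> 'a free_algebra"
  where "gen x = single (Word [x]) 1"

text \<open>The first two families of relations turn the free algebra on the underlying set into the
  tensor algebra of the vector space; the third one then gives the enveloping algebra.\<close>

definition uea_relations :: "'g::complex_lie_algebra free_algebra set"
  where "uea_relations =
    {gen (x + y) - gen x - gen y | x y. True} \<union>
    {gen (c *\<^sub>C x) - c *\<^sub>C gen x | c x. True} \<union>
    {gen x * gen y - gen y * gen x - gen (bracket x y) | x y. True}"

definition uea_ideal_gens :: "'g::complex_lie_algebra free_algebra set"
  where "uea_ideal_gens = {a * r * b | a r b. r \<in> uea_relations}"

definition uea_equiv :: "'g::complex_lie_algebra free_algebra \<Rightarrow> 'g free_algebra \<Rightarrow> bool"
  where "uea_equiv p q \<longleftrightarrow> p - q \<in> complex_vector.span uea_ideal_gens"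

lemma clinear_mult_left: "clinear (\<lambda>x::'a::complex_algebra. a * x)"
  and clinear_mult_right: "clinear (\<lambda>x::'a::complex_algebra. x * a)"
  using cbilinear_left[OF cbilinear_times] cbilinear_right[OF cbilinear_times] by auto

lemma uea_ideal_mult:
  assumes "p \<in> complex_vector.span uea_ideal_gens"
  shows "a * p \<in> complex_vector.span uea_ideal_gens" "p * a \<in> complex_vector.span uea_ideal_gens"
proof -
  have *: "a * g \<in> uea_ideal_gens" "g * a \<in> uea_ideal_gens" if mem: "g \<in> uea_ideal_gens" for g
  proof -
    obtain x r y where g: "g = x * r * y" and r: "r \<in> uea_relations"
      using mem unfolding uea_ideal_gens_def by blast
    have "a * g = (a * x) * r * y" "g * a = x * r * (y * a)"
      by (simp_all add: g mult.assoc)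
    then show "a * g \<in> uea_ideal_gens" "g * a \<in> uea_ideal_gens"
      using r unfolding uea_ideal_gens_def by blast+
  qed
  show "a * p \<in> complex_vector.span uea_ideal_gens" using assms
    by (induction rule: complex_vector.span_induct_alt)
      (auto simp: distrib_left scaleC_mult_right
        intro!: complex_vector.span_zero complex_vector.span_add complex_vector.span_scale
          complex_vector.span_base[OF *(1)])
  show "p * a \<in> complex_vector.span uea_ideal_gens" using assms
    by (induction rule: complex_vector.span_induct_alt)
      (auto simp: distrib_right scaleC_mult_left
        intro!: complex_vector.span_zero complex_vector.span_add complex_vector.span_scale
          complex_vector.span_base[OF *(2)])
qed

quotient_type (overloaded) 'g uea = "'g::complex_lie_algebra free_algebra" / uea_equiv
  unfolding uea_equiv_def by (rule span_diff_equivp)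

definition algebra_eval :: "('x \<Rightarrow> 'a::complex_algebra) \<Rightarrow> 'x free_algebra \<Rightarrow> 'a"
  where "algebra_eval f = free_extend (\<lambda>w. prod_list (map f (letters w)))"

lemma clinear_algebra_eval: "clinear (algebra_eval f)"
  unfolding algebra_eval_def by (rule clinear_free_extend)

lemma algebra_eval_single: "algebra_eval f (single w c) = c *\<^sub>C prod_list (map f (letters w))"
  unfolding algebra_eval_def by (rule free_extend_single)

lemma algebra_eval_gen: "algebra_eval f (gen x) = f x"
  by (simp add: gen_def algebra_eval_single scaleC_one)

lemma algebra_eval_one: "algebra_eval f 1 = 1"
  by (simp add: algebra_eval_single scaleC_one zero_free_monoid_def flip: single_one)

lemma algebra_eval_mult: "algebra_eval f (p * q) = algebra_eval f p * algebra_eval f q"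
proof (rule clinear_poly_mapping_eqI[where p = p])
  show "clinear (\<lambda>p. algebra_eval f (p * q))" "clinear (\<lambda>p. algebra_eval f p * algebra_eval f q)"
    by (rule clinear_compose[OF clinear_algebra_eval clinear_mult_right]
        clinear_compose[OF clinear_mult_right clinear_algebra_eval])+
  show "algebra_eval f (single v 1 * q) = algebra_eval f (single v 1) * algebra_eval f q" for v
  proof (rule clinear_poly_mapping_eqI[where p = q])
    show "clinear (\<lambda>q. algebra_eval f (single v 1 * q))"
      "clinear (\<lambda>q. algebra_eval f (single v 1) * algebra_eval f q)"
      by (rule clinear_compose[OF clinear_algebra_eval clinear_mult_left]
          clinear_compose[OF clinear_mult_left clinear_algebra_eval])+
    show "algebra_eval f (single v 1 * single w 1)
        = algebra_eval f (single v 1) * algebra_eval f (single w 1)" for w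
      by (simp add: mult_single algebra_eval_single scaleC_one plus_free_monoid_def)
  qed
qed

lemma algebra_eval_uea_ideal:
  assumes "clinear f" "\<And>x y. f (bracket x y) = f x * f y - f y * f x"
    and "p \<in> complex_vector.span uea_ideal_gens"
  shows "algebra_eval f p = 0"
proof (rule clinear_vanish_span[OF clinear_algebra_eval _ assms(3)])
  fix r assume "r \<in> (uea_ideal_gens :: 'a free_algebra set)"
  then obtain a s b where r: "r = a * s * b" and s: "s \<in> uea_relations"
    unfolding uea_ideal_gens_def by blast
  from s have "algebra_eval f s = 0"
    unfolding uea_relations_def
    by (auto simp: algebra_eval_gen algebra_eval_mult assms(2) clinear_add[OF assms(1)]
        clinear_scaleC[OF assms(1)] clinear_diff[OF clinear_algebra_eval]
        clinear_scaleC[OF clinear_algebra_eval])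
  then show "algebra_eval f r = 0"
    by (simp add: r algebra_eval_mult)
qed

lemma one_notin_uea_ideal: "1 \<notin> complex_vector.span uea_ideal_gens"
proof
  assume "1 \<in> complex_vector.span (uea_ideal_gens :: 'a free_algebra set)"
  then have "algebra_eval (\<lambda>x::'a. 0::complex) 1 = 0"
    by (intro algebra_eval_uea_ideal clinearI) auto
  then show False
    by (simp add: algebra_eval_one)
qed

instantiation uea :: (complex_lie_algebra) complex_algebra
begin

lift_definition zero_uea :: "'a uea" is 0 .

lift_definition one_uea :: "'a uea" is 1 .

lift_definition plus_uea :: "'a uea \<Rightarrow> 'a uea \<Rightarrow> 'a uea" is "(+)"
  unfolding uea_equiv_def by (rule span_diff_cong_add)

lift_definition minus_uea :: "'a uea \<Rightarrow> 'a uea \<Rightarrow> 'a uea" is "(-)"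
  unfolding uea_equiv_def by (rule span_diff_cong_diff)

lift_definition uminus_uea :: "'a uea \<Rightarrow> 'a uea" is uminus
  unfolding uea_equiv_def by (rule span_diff_cong_minus)

lift_definition scaleC_uea :: "complex \<Rightarrow> 'a uea \<Rightarrow> 'a uea" is scaleC
  unfolding uea_equiv_def by (rule span_diff_cong_scaleC)

lift_definition times_uea :: "'a uea \<Rightarrow> 'a uea \<Rightarrow> 'a uea" is "(*)"
proof -
  fix p p' q q' :: "'a free_algebra"
  assume "uea_equiv p p'" "uea_equiv q q'"
  then have "(p - p') * q + p' * (q - q') \<in> complex_vector.span uea_ideal_gens"
    unfolding uea_equiv_def by (intro complex_vector.span_add uea_ideal_mult)
  then show "uea_equiv (p * q) (p' * q')"
    by (simp add: uea_equiv_def algebra_simps)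
qed

instance
proof
  show "(0::'a uea) \<noteq> 1"
  proof (transfer, unfold uea_equiv_def, rule notI)
    assume "0 - 1 \<in> complex_vector.span (uea_ideal_gens :: 'a free_algebra set)"
    then show False
      using complex_vector.span_neg one_notin_uea_ideal by fastforce
  qed
qed (transfer, simp add: uea_equiv_def complex_vector.span_zero scaleC_add_right scaleC_add_left
    scaleC_scaleC scaleC_one scaleC_mult_left scaleC_mult_right algebra_simps)+

end

lift_definition uea_of :: "'g::complex_lie_algebra \<Rightarrow> 'g uea" is gen .

lemma clinear_uea_of: "clinear uea_of"
proof (intro clinearI; transfer)
  fix x y :: 'a and c
  have *: "r \<in> complex_vector.span uea_ideal_gens" if "r \<in> uea_relations" for r :: "'a free_algebra"
  proof (rule complex_vector.span_base)
    have "1 * r * 1 \<in> uea_ideal_gens"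
      using that unfolding uea_ideal_gens_def by blast
    then show "r \<in> uea_ideal_gens" by simp
  qed
  show "uea_equiv (gen (x + y)) (gen x + gen y)"
    unfolding uea_equiv_def diff_diff_eq[symmetric] uea_relations_def
    by (rule *) (auto simp: uea_relations_def)
  show "uea_equiv (gen (c *\<^sub>C x)) (c *\<^sub>C gen x)"
    unfolding uea_equiv_def by (rule *) (auto simp: uea_relations_def)
qed

lemma uea_of_bracket: "uea_of (bracket x y) = uea_of x * uea_of y - uea_of y * uea_of x"
proof transfer
  fix x y :: 'a
  have "1 * (gen x * gen y - gen y * gen x - gen (bracket x y)) * 1 \<in> uea_ideal_gens"
    unfolding uea_ideal_gens_def uea_relations_def by blast
  then have "- (gen x * gen y - gen y * gen x - gen (bracket x y))
      \<in> complex_vector.span uea_ideal_gens"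
    by (intro complex_vector.span_neg complex_vector.span_base) simp
  then show "uea_equiv (gen (bracket x y)) (gen x * gen y - gen y * gen x)"
    by (simp add: uea_equiv_def)
qed

lemma clinear_abs_uea: "clinear abs_uea"
  by (rule clinearI) (simp_all add: plus_uea.abs_eq scaleC_uea.abs_eq)

lemma abs_uea_cases: obtains p where "u = abs_uea p"
  by (metis Quotient3_abs_rep Quotient3_uea)

theorem uea_universal_property:
  fixes f :: "'g::complex_lie_algebra \<Rightarrow> 'a::complex_algebra"
  assumes "clinear f" "\<And>x y. f (bracket x y) = f x * f y - f y * f x"
  shows "\<exists>!F. clinear F \<and> F 1 = 1 \<and> (\<forall>u v. F (u * v) = F u * F v) \<and> (\<forall>x. F (uea_of x) = f x)"
proof (rule ex1I)
  define F where "F u = algebra_eval f (rep_uea u)" for u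
  have F: "F (abs_uea p) = algebra_eval f p" for p
  proof -
    have "uea_equiv (rep_uea (abs_uea p)) p"
      using Quotient3_uea by (metis Quotient3_abs_rep Quotient3_rel uea.abs_eq_iff)
    then have "algebra_eval f (rep_uea (abs_uea p) - p) = 0"
      unfolding uea_equiv_def by (rule algebra_eval_uea_ideal[OF assms])
    then show ?thesis
      by (simp add: F_def clinear_diff[OF clinear_algebra_eval])
  qed
  have "clinear F"
  proof (rule clinearI)
    fix u v :: "'g uea" and c
    obtain p q where uv: "u = abs_uea p" "v = abs_uea q"
      by (metis abs_uea_cases)
    show "F (u + v) = F u + F v" "F (c *\<^sub>C u) = c *\<^sub>C F u"
      by (simp_all add: uv F plus_uea.abs_eq scaleC_uea.abs_eq clinear_add[OF clinear_algebra_eval]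
          clinear_scaleC[OF clinear_algebra_eval])
  qed
  moreover have "F (u * v) = F u * F v" for u v
  proof -
    obtain p q where uv: "u = abs_uea p" "v = abs_uea q"
      by (metis abs_uea_cases)
    show ?thesis
      by (simp add: uv F times_uea.abs_eq algebra_eval_mult)
  qed
  ultimately show "clinear F \<and> F 1 = 1 \<and> (\<forall>u v. F (u * v) = F u * F v) \<and> (\<forall>x. F (uea_of x) = f x)"
    by (simp add: one_uea.abs_eq uea_of.abs_eq F algebra_eval_one algebra_eval_gen)
next
  fix G :: "'g uea \<Rightarrow> 'a"
  assume G: "clinear G \<and> G 1 = 1 \<and> (\<forall>u v. G (u * v) = G u * G v) \<and> (\<forall>x. G (uea_of x) = f x)"
  have word: "G (abs_uea (single (Word xs) 1)) = prod_list (map f xs)" for xs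
  proof (induction xs)
    case Nil
    then show ?case
      using G by (simp add: one_uea.abs_eq flip: zero_free_monoid_def)
  next
    case (Cons x xs)
    have "single (Word (x # xs)) 1 = gen x * (single (Word xs) 1 :: 'g free_algebra)"
      by (simp add: gen_def mult_single plus_free_monoid_def)
    then show ?case
      using G Cons by (simp add: uea_of.abs_eq flip: times_uea.abs_eq)
  qed
  show "G = (\<lambda>u. algebra_eval f (rep_uea u))"
  proof
    fix u
    have "G (abs_uea p) = algebra_eval f p" for p
    proof (rule clinear_poly_mapping_eqI)
      show "clinear (\<lambda>p. G (abs_uea p))"
        using G by (intro clinear_compose[OF _ clinear_abs_uea]) simp
      show "G (abs_uea (single w 1)) = algebra_eval f (single w 1)" for w
        using word[of "letters w"] by (simp add: algebra_eval_single scaleC_one)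
    qed (rule clinear_algebra_eval)
    then show "G u = algebra_eval f (rep_uea u)"
      by (metis Quotient3_abs_rep Quotient3_uea)
  qed
qed


section \<open>The braided space \<open>V = \<complex> \<oplus> g\<close>\<close>

text \<open>The pair \<open>(c, \<xi>)\<close> stands for \<open>c + \<xi>\<close>; \<open>V_incl\<close> is the inclusion of \<open>V\<close>
  in the enveloping algebra (injective by the Poincare-Birkhoff-Witt theorem, which is not used).\<close>

definition V_one :: "complex \<times> 'g::complex_lie_algebra"
  where "V_one = (1, 0)"

definition V_of :: "'g::complex_lie_algebra \<Rightarrow> complex \<times> 'g"
  where "V_of \<xi> = (0, \<xi>)"

definition V_incl :: "complex \<times> 'g::complex_lie_algebra \<Rightarrow> 'g uea"
  where "V_incl v = fst v *\<^sub>C 1 + uea_of (snd v)"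

lemma clinear_V_of: "clinear V_of"
  by (rule clinearI) (simp_all add: V_of_def scaleC_prod_def)

lemma clinear_snd: "clinear snd"
  by (rule clinearI) (simp_all add: scaleC_prod_def)

lemma V_decompose: "v = fst v *\<^sub>C V_one + V_of (snd v)"
  by (simp add: V_one_def V_of_def scaleC_prod_def scaleC_complex_def prod_eq_iff)

lemma clinear_bracket: "clinear (bracket x)" "clinear (\<lambda>x. bracket x y)"
  by (rule clinearI;
      simp add: bracket_add_left bracket_add_right bracket_scaleC_left bracket_scaleC_right)+

lemma bracket_zero: "bracket x 0 = 0" "bracket 0 x = 0"
  using clinear_zero[OF clinear_bracket(1)] clinear_zero[OF clinear_bracket(2)] by auto

lemma bracket_antisym: "bracket y x = - bracket x y"
proof -
  have "bracket (x + y) (x + y) = bracket x y + bracket y x"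
    by (simp only: bracket_add_left bracket_add_right) (simp add: bracket_self)
  then have "bracket x y + bracket y x = 0"
    by (simp only: bracket_self)
  then show ?thesis
    by (simp add: eq_neg_iff_add_eq_0 add.commute)
qed

definition lie_braiding ::
    "(complex \<times> 'g::complex_lie_algebra) \<otimes> (complex \<times> 'g) \<Rightarrow> (complex \<times> 'g) \<otimes> (complex \<times> 'g)"
  where "lie_braiding = tensor_lift (\<lambda>u v. v \<otimes> u + V_of (bracket (snd u) (snd v)) \<otimes> V_one)"

lemma cbilinear_lie_braiding:
  "cbilinear (\<lambda>u v. v \<otimes> u + V_of (bracket (snd u) (snd v)) \<otimes> V_one)"
proof (intro cbilinearI clinear_plus clinear_pure_left clinear_pure_right)
  show "clinear (\<lambda>v. V_of (bracket (snd u) (snd v)) \<otimes> V_one)" for u :: "complex \<times> 'a"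
    by (rule clinear_compose[OF clinear_pure_left clinear_compose[OF clinear_V_of
          clinear_compose[OF clinear_bracket(1) clinear_snd]]])
  show "clinear (\<lambda>u. V_of (bracket (snd u) (snd v)) \<otimes> V_one)" for v :: "complex \<times> 'a"
    by (rule clinear_compose[OF clinear_pure_left clinear_compose[OF clinear_V_of
          clinear_compose[OF clinear_bracket(2) clinear_snd]]])
qed

lemma clinear_lie_braiding: "clinear lie_braiding"
  unfolding lie_braiding_def by (rule clinear_tensor_lift[OF cbilinear_lie_braiding])

lemma lie_braiding_pure:
  "lie_braiding (u \<otimes> v) = v \<otimes> u + V_of (bracket (snd u) (snd v)) \<otimes> V_one"
  unfolding lie_braiding_def by (rule tensor_lift_pure[OF cbilinear_lie_braiding])

lemma
  assumes "clinear \<Psi>"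
  shows clinear_braid12: "clinear (braid12 \<Psi>)" and clinear_braid23: "clinear (braid23 \<Psi>)"
    and braid12_pure: "braid12 \<Psi> (s \<otimes> c) = \<Psi> s \<otimes> c"
    and braid23_pure: "braid23 \<Psi> ((a \<otimes> b) \<otimes> c) = tensor_assoc_inv (a \<otimes> \<Psi> (b \<otimes> c))"
  using clinear_compose[OF clinear_tensor_assoc_inv
      clinear_compose[OF clinear_tensor_map[OF clinear_id assms] clinear_tensor_assoc]]
    clinear_tensor_map[OF assms clinear_id]
  by (simp_all add: braid12_def braid23_def tensor_assoc_pure comp_def id_def
      tensor_map_pure[OF assms clinear_id] tensor_map_pure[OF clinear_id assms])

lemma braiding_lie_braiding: "braiding lie_braiding"
proof -
  let ?P = "lie_braiding :: (complex \<times> 'a) \<otimes> (complex \<times> 'a) \<Rightarrow> _"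
  let ?L = "\<lambda>t. braid23 ?P (braid12 ?P (braid23 ?P t))"
  let ?R = "\<lambda>t. braid12 ?P (braid23 ?P (braid12 ?P t))"
  note lin = clinear_lie_braiding
  note c12 = clinear_braid12[OF lin] and c23 = clinear_braid23[OF lin]
  have L: "clinear ?L" and R: "clinear ?R"
    by (rule clinear_compose[OF c23 clinear_compose[OF c12 c23]]
        clinear_compose[OF c12 clinear_compose[OF c23 c12]])+
  have pure: "?L ((u \<otimes> v) \<otimes> w) = ?R ((u \<otimes> v) \<otimes> w)" for u v w
  proof -
    obtain x y z where xyz: "x = snd u" "y = snd v" "z = snd w" by blast
    have "bracket x (bracket y z) = bracket (bracket x y) z + bracket y (bracket x z)"
    proof -
      have 1: "bracket z x = - bracket x z"
        and 2: "bracket z (bracket x y) = - bracket (bracket x y) z"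
        by (rule bracket_antisym)+
      have 3: "bracket y (- t) = - bracket y t" for t
        using clinear_diff[OF clinear_bracket(1), of y 0 t] by (simp add: bracket_zero)
      show ?thesis
        using jacobi[of x y z] unfolding 1 2 3 by (simp add: algebra_simps)
    qed
    then have jac: "V_of (bracket x (bracket y z))
        = V_of (bracket (bracket x y) z) + V_of (bracket y (bracket x z))"
      by (simp add: clinear_add[OF clinear_V_of])
    have snd: "snd (V_of \<xi>) = \<xi>" "snd V_one = (0::'a)" "V_of (0::'a) = 0" for \<xi> :: 'a
      by (simp_all add: V_of_def V_one_def zero_prod_def)
    show ?thesis
      by (simp add: braid12_pure[OF lin] braid23_pure[OF lin] lie_braiding_pure
          clinear_add[OF c12] clinear_add[OF c23] clinear_add[OF clinear_pure_left]
          clinear_add[OF clinear_pure_right] clinear_add[OF clinear_tensor_assoc_inv]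
          clinear_zero[OF clinear_pure_left] tensor_assoc_inv_pure snd bracket_zero jac
          flip: xyz)
  qed
  have "?L (s \<otimes> w) = ?R (s \<otimes> w)" for s w
    by (rule clinear_tensor_eqI[where t = s, OF clinear_compose[OF L clinear_pure_left]
          clinear_compose[OF R clinear_pure_left] pure])
  then have "?L t = ?R t" for t
    by (rule clinear_tensor_eqI[OF L R])
  then show ?thesis
    by (simp add: braiding_def lin fun_eq_iff)
qed

theorem lie_braiding_unique:
  "\<exists>!\<psi> :: (complex \<times> 'g::complex_lie_algebra) \<otimes> (complex \<times> 'g) \<Rightarrow> _. braiding \<psi>
    \<and> \<psi> (V_one \<otimes> V_one) = V_one \<otimes> V_one
    \<and> (\<forall>\<xi>. \<psi> (V_one \<otimes> V_of \<xi>) = V_of \<xi> \<otimes> V_one)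
    \<and> (\<forall>\<xi>. \<psi> (V_of \<xi> \<otimes> V_one) = V_one \<otimes> V_of \<xi>)
    \<and> (\<forall>\<xi> \<eta>. \<psi> (V_of \<xi> \<otimes> V_of \<eta>) = V_of \<eta> \<otimes> V_of \<xi> + V_of (bracket \<xi> \<eta>) \<otimes> V_one)"
    (is "\<exists>!\<psi>. ?E \<psi>")
proof (rule ex1I)
  have snd: "snd (V_of \<xi>) = \<xi>" "snd V_one = (0::'g)" "V_of (0::'g) = 0" for \<xi> :: 'g
    by (simp_all add: V_of_def V_one_def zero_prod_def)
  show E: "?E lie_braiding"
    by (simp add: braiding_lie_braiding lie_braiding_pure snd bracket_zero
        clinear_zero[OF clinear_pure_left])
  fix \<psi> :: "(complex \<times> 'g) \<otimes> (complex \<times> 'g) \<Rightarrow> (complex \<times> 'g) \<otimes> (complex \<times> 'g)"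
  assume \<psi>: "?E \<psi>"
  then have lin: "clinear \<psi>" by (simp add: braiding_def)
  show "\<psi> = lie_braiding"
  proof
    fix t
    show "\<psi> t = lie_braiding t"
    proof (rule clinear_tensor_eqI[OF lin clinear_lie_braiding])
      fix u v :: "complex \<times> 'g"
      obtain a b \<xi> \<eta> where uv: "u = a *\<^sub>C V_one + V_of \<xi>" "v = b *\<^sub>C V_one + V_of \<eta>"
        using V_decompose by blast
      show "\<psi> (u \<otimes> v) = lie_braiding (u \<otimes> v)"
        unfolding uv clinear_add[OF clinear_pure_left] clinear_add[OF clinear_pure_right]
          clinear_scaleC[OF clinear_pure_left] clinear_scaleC[OF clinear_pure_right]
          clinear_add[OF lin] clinear_add[OF clinear_lie_braiding]
          clinear_scaleC[OF lin] clinear_scaleC[OF clinear_lie_braiding]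
        using \<psi> E by simp
    qed
  qed
qed

end

theory Submission
  imports Defs
begin

text \<open>For \<open>\<xi> \<in> g\<close> let \<open>L\<^sub>\<xi>\<close> be left multiplication by \<open>\<xi>\<close> on \<open>U(g)\<close> and
  \<open>ad\<^sub>\<xi>\<close> the commutator with \<open>\<xi>\<close>. The operators \<open>ad\<^sub>\<xi> \<otimes> 1 + 1 \<otimes> L\<^sub>\<xi>\<close> represent \<open>g\<close>,
  hence \<open>U(g)\<close>, on \<open>U(g) \<otimes> U(g)\<close>, and \<open>\<Psi>(a \<otimes> b) = a \<cdot> (b \<otimes> 1)\<close>; in Hopf algebra notation
  this is \<open>a\<^sub>1 b S(a\<^sub>2) \<otimes> a\<^sub>3\<close>, but no coproduct is needed. By construction \<open>\<Psi>\<close>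
  intertwines \<open>L\<^sub>\<xi> \<otimes> 1\<close> with \<open>ad\<^sub>\<xi> \<otimes> 1 + 1 \<otimes> L\<^sub>\<xi>\<close>, and it commutes with
  \<open>ad\<^sub>\<xi> \<otimes> 1 + 1 \<otimes> ad\<^sub>\<xi>\<close>. Consequently both sides of the braid relation
  intertwine \<open>L\<^sub>\<xi> \<otimes> 1 \<otimes> 1\<close> with \<open>ad\<^sub>\<xi> \<otimes> 1 \<otimes> 1 + 1 \<otimes> ad\<^sub>\<xi> \<otimes> 1 + 1 \<otimes> 1 \<otimes> L\<^sub>\<xi>\<close>, so it
  suffices to compare them on \<open>1 \<otimes> b \<otimes> c\<close>.\<close>

section \<open>Induction along words in U(g)\<close>

lemma clinear_uea_eqI:
  assumes F: "clinear F" and G: "clinear G" and one: "F 1 = G 1"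
    and step: "\<And>x u. F u = G u \<Longrightarrow> F (uea_of x * u) = G (uea_of x * u)"
  shows "F u = G u"
proof -
  \<comment> \<open>Classes of words span U(g), and every word arises from 1 by prefixing one
    generator at a time; this is why a step for left multiplication by \<open>uea_of x\<close> is
    enough.\<close>
  have word: "F (abs_uea (single (Word xs) 1)) = G (abs_uea (single (Word xs) 1))" for xs
  proof (induction xs)
    case Nil
    then show ?case
      using one by (simp add: one_uea.abs_eq flip: zero_free_monoid_def)
  next
    case (Cons x xs)
    have "single (Word (x # xs)) 1 = gen x * (single (Word xs) 1 :: 'a free_algebra)"
      by (simp add: gen_def mult_single plus_free_monoid_def)
    then show ?case
      using step[OF Cons, of x] by (simp add: uea_of.abs_eq flip: times_uea.abs_eq)
  qed
  obtain p where u: "u = abs_uea p"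
    by (rule abs_uea_cases)
  show ?thesis
    unfolding u
  proof (rule clinear_poly_mapping_eqI)
    show "clinear (\<lambda>p. F (abs_uea p))" "clinear (\<lambda>p. G (abs_uea p))"
      by (rule clinear_compose[OF F clinear_abs_uea] clinear_compose[OF G clinear_abs_uea])+
    show "F (abs_uea (single w 1)) = G (abs_uea (single w 1))" for w
      using word[of "letters w"] by simp
  qed
qed

section \<open>From representations of g to actions of U(g)\<close>

locale lie_representation =
  fixes \<rho> :: "'g::complex_lie_algebra \<Rightarrow> 'w::complex_vector \<Rightarrow> 'w"
  assumes cbilinear: "cbilinear \<rho>"
    and bracket: "\<rho> (bracket x y) w = \<rho> x (\<rho> y w) - \<rho> y (\<rho> x w)"
begin

text \<open>Acting on vectors by \<open>foldr\<close> avoids turning the linear endomorphisms of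
  \<open>'w\<close> into a type of class \<open>complex_algebra\<close>, as an appeal to
  \<open>uea_universal_property\<close> would require.\<close>

definition free_act :: "'g free_algebra \<Rightarrow> 'w \<Rightarrow> 'w"
  where "free_act p w = free_extend (\<lambda>m. foldr \<rho> (letters m) w) p"

text \<open>Evaluated on a chosen representative; \<open>uea_act_abs\<close> shows that the choice
  does not matter.\<close>

definition uea_act :: "'g uea \<Rightarrow> 'w \<Rightarrow> 'w"
  where "uea_act u = free_act (rep_uea u)"

lemma clinear_foldr: "clinear (foldr \<rho> xs)"
proof (induction xs)
  case Nil
  then show ?case by (simp add: id_def clinear_id)
next
  case (Cons x xs)
  then show ?case
    using clinear_compose[OF cbilinear_right[OF cbilinear]] by (simp add: comp_def)
qed

lemma cbilinear_free_act: "cbilinear free_act"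
proof (rule cbilinearI)
  show "clinear (\<lambda>p. free_act p w)" for w
    unfolding free_act_def by (rule clinear_free_extend)
  show "clinear (free_act p)" for p
    unfolding free_act_def free_extend_def
    by (rule clinearI) (simp_all add: clinear_add[OF clinear_foldr] clinear_scaleC[OF clinear_foldr]
        scaleC_add_right sum.distrib complex_vector.scale_sum_right scaleC_scaleC mult.commute)
qed

lemma free_act_single: "free_act (single m 1) w = foldr \<rho> (letters m) w"
  by (simp add: free_act_def free_extend_single scaleC_one)

lemma free_act_gen: "free_act (gen x) w = \<rho> x w"
  by (simp add: gen_def free_act_single)

lemma free_act_mult: "free_act (p * q) w = free_act p (free_act q w)"
proof (rule clinear_poly_mapping_eqI[where p = p])
  note left = cbilinear_left[OF cbilinear_free_act] and right = cbilinear_right[OF cbilinear_free_act]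
  show "clinear (\<lambda>p. free_act (p * q) w)"
    by (rule clinear_compose[OF left clinear_mult_right])
  show "clinear (\<lambda>p. free_act p (free_act q w))"
    by (rule left)
  show "free_act (single v 1 * q) w = free_act (single v 1) (free_act q w)" for v
  proof (rule clinear_poly_mapping_eqI[where p = q])
    show "clinear (\<lambda>q. free_act (single v 1 * q) w)"
      by (rule clinear_compose[OF left clinear_mult_left])
    show "clinear (\<lambda>q. free_act (single v 1) (free_act q w))"
      by (rule clinear_compose[OF right left])
    show "free_act (single v 1 * single m 1) w = free_act (single v 1) (free_act (single m 1) w)" for m
      by (simp add: mult_single free_act_single plus_free_monoid_def)
  qed
qed

text \<open>Linearity of \<open>\<rho>\<close> in its first argument kills the first two families of
  relations and \<open>bracket\<close> the third. Multiplicativity of the action carries this over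
  to the products \<open>a * s * b\<close>.\<close>

lemma free_act_uea_ideal:
  assumes "p \<in> complex_vector.span uea_ideal_gens"
  shows "free_act p w = 0"
proof (rule clinear_vanish_span[OF cbilinear_left[OF cbilinear_free_act] _ assms])
  note left = cbilinear_left[OF cbilinear_free_act]
  fix r assume "r \<in> (uea_ideal_gens :: 'g free_algebra set)"
  then obtain a s b where r: "r = a * s * b" and s: "s \<in> uea_relations"
    unfolding uea_ideal_gens_def by blast
  have "free_act s v = 0" for v
    using s unfolding uea_relations_def
    by (auto simp: clinear_diff[OF left] clinear_scaleC[OF left] free_act_gen free_act_mult bracket
        clinear_add[OF cbilinear_left[OF cbilinear]] clinear_scaleC[OF cbilinear_left[OF cbilinear]])
  then show "free_act r w = 0"
    by (simp add: r free_act_mult clinear_zero[OF cbilinear_right[OF cbilinear_free_act]])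
qed

lemma uea_act_abs: "uea_act (abs_uea p) = free_act p"
proof
  fix w
  have "uea_equiv (rep_uea (abs_uea p)) p"
    using Quotient3_uea by (metis Quotient3_abs_rep Quotient3_rel uea.abs_eq_iff)
  then have "free_act (rep_uea (abs_uea p) - p) w = 0"
    unfolding uea_equiv_def by (rule free_act_uea_ideal)
  then show "uea_act (abs_uea p) w = free_act p w"
    by (simp add: uea_act_def clinear_diff[OF cbilinear_left[OF cbilinear_free_act]])
qed

lemma cbilinear_uea_act: "cbilinear uea_act"
proof (intro cbilinearI clinearI)
  fix u v :: "'g uea" and w w' :: 'w and c
  obtain p q where uv: "u = abs_uea p" "v = abs_uea q"
    by (metis abs_uea_cases)
  note left = cbilinear_left[OF cbilinear_free_act] and right = cbilinear_right[OF cbilinear_free_act]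
  show "uea_act (u + v) w = uea_act u w + uea_act v w" "uea_act (c *\<^sub>C u) w = c *\<^sub>C uea_act u w"
    "uea_act u (w + w') = uea_act u w + uea_act u w'" "uea_act u (c *\<^sub>C w) = c *\<^sub>C uea_act u w"
    by (simp_all add: uv uea_act_abs plus_uea.abs_eq scaleC_uea.abs_eq clinear_add[OF left]
        clinear_scaleC[OF left] clinear_add[OF right] clinear_scaleC[OF right])
qed

lemma uea_act_one: "uea_act 1 w = w"
  by (simp add: one_uea.abs_eq uea_act_abs free_act_single zero_free_monoid_def flip: single_one)

lemma uea_act_uea_of_mult: "uea_act (uea_of x * u) w = \<rho> x (uea_act u w)"
proof -
  obtain p where u: "u = abs_uea p"
    by (rule abs_uea_cases)
  show ?thesis
    by (simp add: u uea_of.abs_eq times_uea.abs_eq uea_act_abs free_act_mult free_act_gen)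
qed

end

section \<open>Adjoint operators on U(g) and its tensor square\<close>

definition uea_ad :: "'g::complex_lie_algebra \<Rightarrow> 'g uea \<Rightarrow> 'g uea"
  where "uea_ad x u = uea_of x * u - u * uea_of x"

lemma cbilinear_uea_ad: "cbilinear uea_ad"
  by (intro cbilinearI clinearI)
    (simp_all add: uea_ad_def clinear_add[OF clinear_uea_of] clinear_scaleC[OF clinear_uea_of]
      scaleC_mult_left scaleC_mult_right algebra_simps complex_vector.scale_right_diff_distrib)

lemmas clinear_uea_ad = cbilinear_right[OF cbilinear_uea_ad]

lemma uea_ad_one: "uea_ad x 1 = 0"
  by (simp add: uea_ad_def)

lemma uea_ad_uea_of: "uea_ad x (uea_of y) = uea_of (bracket x y)"
  by (simp add: uea_ad_def uea_of_bracket)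

lemma uea_ad_mult: "uea_ad x (u * v) = uea_ad x u * v + u * uea_ad x v"
  by (simp add: uea_ad_def algebra_simps)

lemma uea_ad_bracket: "uea_ad (bracket x y) u = uea_ad x (uea_ad y u) - uea_ad y (uea_ad x u)"
  by (simp add: uea_ad_def uea_of_bracket algebra_simps)

definition ad_mult :: "'g::complex_lie_algebra \<Rightarrow> 'g uea \<otimes> 'g uea \<Rightarrow> 'g uea \<otimes> 'g uea"
  where "ad_mult x t = tensor_map (uea_ad x) id t + tensor_map id ((*) (uea_of x)) t"

definition ad_ad :: "'g::complex_lie_algebra \<Rightarrow> 'g uea \<otimes> 'g uea \<Rightarrow> 'g uea \<otimes> 'g uea"
  where "ad_ad x t = tensor_map (uea_ad x) id t + tensor_map id (uea_ad x) t"

lemma clinear_id_const: "clinear id"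
  by (simp add: id_def clinear_id)

lemmas tensor_linear_simps =
  clinear_add[OF clinear_pure_left] clinear_add[OF clinear_pure_right]
  clinear_diff[OF clinear_pure_left] clinear_diff[OF clinear_pure_right]
  clinear_scaleC[OF clinear_pure_left] clinear_scaleC[OF clinear_pure_right]
  clinear_zero[OF clinear_pure_left] clinear_zero[OF clinear_pure_right]

lemma clinear_ad_mult: "clinear (ad_mult x)" and clinear_ad_ad: "clinear (ad_ad x)"
  unfolding ad_mult_def ad_ad_def
  by (intro clinear_plus clinear_tensor_map clinear_uea_ad clinear_mult_left clinear_id_const)+

lemma ad_mult_pure: "ad_mult x (u \<otimes> v) = uea_ad x u \<otimes> v + u \<otimes> (uea_of x * v)"
  by (simp add: ad_mult_def tensor_map_pure clinear_uea_ad clinear_mult_left clinear_id_const)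

lemma ad_ad_pure: "ad_ad x (u \<otimes> v) = uea_ad x u \<otimes> v + u \<otimes> uea_ad x v"
  by (simp add: ad_ad_def tensor_map_pure clinear_uea_ad clinear_id_const)

lemma clinear_minus: "clinear f \<Longrightarrow> clinear g \<Longrightarrow> clinear (\<lambda>x. f x - g x)"
  by (rule clinearI)
    (auto simp: clinear_add clinear_scaleC complex_vector.scale_right_diff_distrib)

lemma cbilinear_ad_mult: "cbilinear ad_mult"
proof (intro cbilinearI clinear_ad_mult clinearI)
  note ad = cbilinear_left[OF cbilinear_uea_ad]
  fix t :: "'a uea \<otimes> 'a uea" and x y :: 'a and c
  show "ad_mult (x + y) t = ad_mult x t + ad_mult y t"
    by (rule clinear_tensor_eqI[OF clinear_ad_mult clinear_plus[OF clinear_ad_mult clinear_ad_mult]])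
      (simp add: ad_mult_pure clinear_add[OF ad] clinear_add[OF clinear_uea_of] distrib_right
        tensor_linear_simps)
  show "ad_mult (c *\<^sub>C x) t = c *\<^sub>C ad_mult x t"
    by (rule clinear_tensor_eqI[OF clinear_ad_mult clinear_scale[OF clinear_ad_mult]])
      (simp add: ad_mult_pure clinear_scaleC[OF ad] clinear_scaleC[OF clinear_uea_of]
        scaleC_mult_left scaleC_add_right tensor_linear_simps)
qed

text \<open>Adjoint action and left multiplication each represent g. They act on different tensor
  factors, so the mixed terms of the commutator cancel.\<close>

global_interpretation ad_mult: lie_representation ad_mult
proof
  show "cbilinear ad_mult"
    by (rule cbilinear_ad_mult)
  fix x y :: 'a and t
  note c = clinear_compose[OF clinear_ad_mult clinear_ad_mult]
  show "ad_mult (bracket x y) t = ad_mult x (ad_mult y t) - ad_mult y (ad_mult x t)"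
    by (rule clinear_tensor_eqI[OF clinear_ad_mult clinear_minus[OF c c]])
      (simp add: ad_mult_pure uea_ad_bracket uea_of_bracket clinear_add[OF clinear_ad_mult]
        left_diff_distrib mult.assoc tensor_linear_simps)
qed

section \<open>The braiding on U(g) and its intertwining properties\<close>

definition uea_braiding :: "'g::complex_lie_algebra uea \<otimes> 'g uea \<Rightarrow> 'g uea \<otimes> 'g uea"
  where "uea_braiding = tensor_lift (\<lambda>a b. ad_mult.uea_act a (b \<otimes> 1))"

lemma cbilinear_uea_braiding: "cbilinear (\<lambda>a b. ad_mult.uea_act a (b \<otimes> 1))"
  by (rule cbilinearI cbilinear_left[OF ad_mult.cbilinear_uea_act]
      clinear_compose[OF cbilinear_right[OF ad_mult.cbilinear_uea_act] clinear_pure_left])+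

lemma clinear_uea_braiding: "clinear uea_braiding"
  unfolding uea_braiding_def by (rule clinear_tensor_lift[OF cbilinear_uea_braiding])

lemma uea_braiding_pure: "uea_braiding (a \<otimes> b) = ad_mult.uea_act a (b \<otimes> 1)"
  unfolding uea_braiding_def by (rule tensor_lift_pure[OF cbilinear_uea_braiding])

lemma uea_braiding_one: "uea_braiding (1 \<otimes> b) = b \<otimes> 1"
  by (simp add: uea_braiding_pure ad_mult.uea_act_one)

lemma uea_braiding_uea_of_mult:
  "uea_braiding ((uea_of x * a) \<otimes> b) = ad_mult x (uea_braiding (a \<otimes> b))"
  by (simp add: uea_braiding_pure ad_mult.uea_act_uea_of_mult)

lemma uea_braiding_uea_of: "uea_braiding (uea_of x \<otimes> b) = uea_ad x b \<otimes> 1 + b \<otimes> uea_of x"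
  using uea_braiding_uea_of_mult[of x 1 b] by (simp add: uea_braiding_one ad_mult_pure)

text \<open>The recursion in the first factor as an identity of operators on all tensors, the form
  that can be transported to the triple tensor product.\<close>

lemma uea_braiding_mult_left:
  "uea_braiding (tensor_map ((*) (uea_of x)) id t) = ad_mult x (uea_braiding t)"
  by (rule clinear_tensor_eqI
      [OF clinear_compose[OF clinear_uea_braiding clinear_tensor_map[OF clinear_mult_left clinear_id_const]]
        clinear_compose[OF clinear_ad_mult clinear_uea_braiding]])
    (simp add: tensor_map_pure[OF clinear_mult_left clinear_id_const] uea_braiding_uea_of_mult)

text \<open>On the first factor this is the representation property of \<open>uea_ad\<close>. On the
  second, \<open>uea_ad x\<close> is a derivation sending \<open>uea_of y\<close> to
  \<open>uea_of (bracket x y)\<close>, so moving it past left multiplication by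
  \<open>uea_of y\<close> leaves left multiplication by the bracket.\<close>

lemma ad_ad_ad_mult: "ad_ad x (ad_mult y t) = ad_mult (bracket x y) t + ad_mult y (ad_ad x t)"
  by (rule clinear_tensor_eqI[OF clinear_compose[OF clinear_ad_ad clinear_ad_mult]
        clinear_plus[OF clinear_ad_mult clinear_compose[OF clinear_ad_mult clinear_ad_ad]]])
    (simp add: ad_mult_pure ad_ad_pure clinear_add[OF clinear_ad_mult] clinear_add[OF clinear_ad_ad]
      uea_ad_bracket uea_ad_mult uea_ad_uea_of tensor_linear_simps)

text \<open>Induction on the first factor. At 1 both sides are
  \<open>uea_ad x b \<otimes> 1\<close>. Prefixing \<open>uea_of y\<close> adds one term with
  \<open>bracket x y\<close> on the left by the derivation rule, and \<open>ad_ad_ad_mult\<close>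
  yields the same term on the right.\<close>

lemma uea_braiding_ad_ad: "uea_braiding (ad_ad x t) = ad_ad x (uea_braiding t)"
proof (rule clinear_tensor_eqI[OF clinear_compose[OF clinear_uea_braiding clinear_ad_ad]
      clinear_compose[OF clinear_ad_ad clinear_uea_braiding]])
  fix a b :: "'a uea"
  note add = clinear_add[OF clinear_uea_braiding]
  show "uea_braiding (ad_ad x (a \<otimes> b)) = ad_ad x (uea_braiding (a \<otimes> b))"
  proof (rule clinear_uea_eqI[where u = a])
    show "clinear (\<lambda>a. uea_braiding (ad_ad x (a \<otimes> b)))"
      by (rule clinear_compose[OF clinear_uea_braiding clinear_compose[OF clinear_ad_ad clinear_pure_left]])
    show "clinear (\<lambda>a. ad_ad x (uea_braiding (a \<otimes> b)))"
      by (rule clinear_compose[OF clinear_ad_ad clinear_compose[OF clinear_uea_braiding clinear_pure_left]])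
    show "uea_braiding (ad_ad x (1 \<otimes> b)) = ad_ad x (uea_braiding (1 \<otimes> b))"
      by (simp add: ad_ad_pure uea_ad_one uea_braiding_one tensor_linear_simps)
    fix y a
    assume IH: "uea_braiding (ad_ad x (a \<otimes> b)) = ad_ad x (uea_braiding (a \<otimes> b))"
    have "ad_ad x ((uea_of y * a) \<otimes> b)
        = (uea_of (bracket x y) * a) \<otimes> b + tensor_map ((*) (uea_of y)) id (ad_ad x (a \<otimes> b))"
      by (simp add: ad_ad_pure uea_ad_mult uea_ad_uea_of tensor_linear_simps
          clinear_add[OF clinear_tensor_map[OF clinear_mult_left clinear_id_const]]
          tensor_map_pure[OF clinear_mult_left clinear_id_const])
    then show "uea_braiding (ad_ad x ((uea_of y * a) \<otimes> b)) = ad_ad x (uea_braiding ((uea_of y * a) \<otimes> b))"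
      by (simp add: add uea_braiding_mult_left uea_braiding_uea_of_mult IH ad_ad_ad_mult)
  qed
qed

section \<open>Braided commutativity\<close>

lemma algebra_mult_uea_braiding: "algebra_mult (uea_braiding t) = algebra_mult t"
proof -
  have lin: "clinear (algebra_mult :: 'a uea \<otimes> 'a uea \<Rightarrow> 'a uea)"
    unfolding algebra_mult_def by (rule clinear_tensor_lift[OF cbilinear_times])
  \<comment> \<open>With x written for \<open>uea_of x\<close>: (xu - ux)v + u(xv) = xuv. Hence both
    sides of the claim obey the same recursion in the first factor.\<close>
  have ad_mult: "algebra_mult (ad_mult x t) = uea_of x * algebra_mult t" for x :: 'a and t
    by (rule clinear_tensor_eqI[OF clinear_compose[OF lin clinear_ad_mult]
          clinear_compose[OF clinear_mult_left lin]])
      (simp add: ad_mult_pure clinear_add[OF lin] algebra_mult_pure uea_ad_def algebra_simps)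
  have "algebra_mult (uea_braiding (a \<otimes> b)) = a * b" for a b :: "'a uea"
  proof (rule clinear_uea_eqI[where u = a])
    show "clinear (\<lambda>a. algebra_mult (uea_braiding (a \<otimes> b)))"
      by (rule clinear_compose[OF lin clinear_compose[OF clinear_uea_braiding clinear_pure_left]])
    show "clinear (\<lambda>a. a * b)"
      by (rule clinear_mult_right)
  qed (simp_all add: uea_braiding_one algebra_mult_pure uea_braiding_uea_of_mult ad_mult mult.assoc)
  then have "algebra_mult (uea_braiding (a \<otimes> b)) = algebra_mult (a \<otimes> b)" for a b :: "'a uea"
    by (simp add: algebra_mult_pure)
  then show ?thesis
    by (rule clinear_tensor_eqI[OF clinear_compose[OF lin clinear_uea_braiding] lin])
qed

section \<open>Operators on the triple tensor product\<close>

lemma clinear_triple_tensor_eqI: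
  assumes "clinear F" "clinear G" "\<And>a b c. F ((a \<otimes> b) \<otimes> c) = G ((a \<otimes> b) \<otimes> c)"
  shows "F t = G t"
proof (rule clinear_tensor_eqI[OF assms(1,2)])
  show "F (s \<otimes> c) = G (s \<otimes> c)" for s c
    by (rule clinear_tensor_eqI[OF clinear_compose[OF assms(1) clinear_pure_left]
          clinear_compose[OF assms(2) clinear_pure_left]]) (rule assms(3))
qed

text \<open>Transports an intertwining relation on the tensor square to either adjacent pair of
  factors. For the last pair, the associators between the two maps have to cancel.\<close>

lemma
  fixes F G H K :: "'a::complex_vector \<otimes> 'a \<Rightarrow> 'a \<otimes> 'a"
  assumes lin: "clinear F" "clinear G" "clinear H" "clinear K"
    and eq: "\<And>s. F (G s) = H (K s)"
  shows braid12_intertwine: "braid12 F (braid12 G t) = braid12 H (braid12 K t)"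
    and braid23_intertwine: "braid23 F (braid23 G t) = braid23 H (braid23 K t)"
proof -
  show "braid12 F (braid12 G t) = braid12 H (braid12 K t)"
    by (rule clinear_tensor_eqI[OF clinear_compose[OF clinear_braid12 clinear_braid12]
          clinear_compose[OF clinear_braid12 clinear_braid12]])
      (simp_all add: braid12_pure lin eq)
  have inverse: "tensor_assoc (tensor_assoc_inv t) = t" for t :: "'a \<otimes> ('a \<otimes> 'a)"
  proof (rule clinear_tensor_eqI[OF clinear_compose[OF clinear_tensor_assoc clinear_tensor_assoc_inv]
        clinear_id])
    show "tensor_assoc (tensor_assoc_inv (a \<otimes> s)) = a \<otimes> s" for a :: 'a and s :: "'a \<otimes> 'a"
      by (rule clinear_tensor_eqI[where t = s, OF clinear_compose[OF clinear_compose[OF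
              clinear_tensor_assoc clinear_tensor_assoc_inv] clinear_pure_right] clinear_pure_right])
        (simp add: tensor_assoc_inv_pure tensor_assoc_pure)
  qed
  show "braid23 F (braid23 G t) = braid23 H (braid23 K t)"
  proof (rule clinear_triple_tensor_eqI[OF clinear_compose[OF clinear_braid23 clinear_braid23]
        clinear_compose[OF clinear_braid23 clinear_braid23]])
    show "braid23 F (braid23 G ((a \<otimes> b) \<otimes> c)) = braid23 H (braid23 K ((a \<otimes> b) \<otimes> c))" for a b c
      by (simp add: braid23_pure lin)
        (simp add: braid23_def inverse tensor_map_pure clinear_id_const lin eq)
  qed (fact lin)+
qed

lemma
  assumes "clinear F" "clinear G"
  shows braid12_plus: "braid12 (\<lambda>s. F s + G s) t = braid12 F t + braid12 G t"
    and braid23_plus: "braid23 (\<lambda>s. F s + G s) t = braid23 F t + braid23 G t"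
proof -
  show "braid12 (\<lambda>s. F s + G s) t = braid12 F t + braid12 G t"
    by (rule clinear_tensor_eqI[OF clinear_braid12 clinear_plus[OF clinear_braid12 clinear_braid12]])
      (simp_all add: braid12_pure clinear_plus assms tensor_linear_simps)
  show "braid23 (\<lambda>s. F s + G s) t = braid23 F t + braid23 G t"
    by (rule clinear_triple_tensor_eqI[OF clinear_braid23
          clinear_plus[OF clinear_braid23 clinear_braid23]])
      (simp_all add: braid23_pure clinear_plus assms tensor_linear_simps
        clinear_add[OF clinear_tensor_assoc_inv])
qed

text \<open>The middle factor belongs to both adjacent pairs, so an operator on it can take part in
  relations for either pair.\<close>

lemma braid12_second_eq_braid23_first:
  assumes "clinear f"
  shows "braid12 (tensor_map id f) t = braid23 (tensor_map f id) t"
  by (rule clinear_triple_tensor_eqI[OF clinear_braid12 clinear_braid23])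
    (simp_all add: braid12_pure braid23_pure clinear_tensor_map assms clinear_id_const tensor_map_pure
      tensor_assoc_inv_pure)

lemma braid12_third_commute:
  assumes F: "clinear F" and f: "clinear f"
  shows "braid12 F (braid23 (tensor_map id f) t) = braid23 (tensor_map id f) (braid12 F t)"
proof -
  note idf = clinear_tensor_map[OF clinear_id_const f]
  \<comment> \<open>Needed for arbitrary \<open>s\<close>, since \<open>F\<close> need not send pure
    tensors to pure tensors.\<close>
  have third: "braid23 (tensor_map id f) (s \<otimes> c) = s \<otimes> f c" for s c
    by (rule clinear_tensor_eqI[where t = s, OF clinear_compose[OF clinear_braid23[OF idf]
            clinear_pure_left] clinear_pure_left])
      (simp add: braid23_pure[OF idf] tensor_map_pure[OF clinear_id_const f] tensor_assoc_inv_pure)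
  show ?thesis
    by (rule clinear_tensor_eqI[OF clinear_compose[OF clinear_braid12[OF F] clinear_braid23[OF idf]]
          clinear_compose[OF clinear_braid23[OF idf] clinear_braid12[OF F]]])
      (simp add: third braid12_pure[OF F])
qed

lemma braid23_first_commute:
  assumes F: "clinear F" and f: "clinear f"
  shows "braid23 F (braid12 (tensor_map f id) t) = braid12 (tensor_map f id) (braid23 F t)"
proof -
  note fid = clinear_tensor_map[OF f clinear_id_const]
  have first: "braid12 (tensor_map f id) (tensor_assoc_inv (a \<otimes> s)) = tensor_assoc_inv (f a \<otimes> s)"
    for a s
    by (rule clinear_tensor_eqI[where t = s, OF
          clinear_compose[OF clinear_braid12[OF fid] clinear_compose[OF clinear_tensor_assoc_inv
              clinear_pure_right]]
          clinear_compose[OF clinear_tensor_assoc_inv clinear_pure_right]])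
      (simp add: braid12_pure[OF fid] tensor_map_pure[OF f clinear_id_const] tensor_assoc_inv_pure)
  show ?thesis
    by (rule clinear_triple_tensor_eqI[OF
          clinear_compose[OF clinear_braid23[OF F] clinear_braid12[OF fid]]
          clinear_compose[OF clinear_braid12[OF fid] clinear_braid23[OF F]]])
      (simp add: first braid12_pure[OF fid] tensor_map_pure[OF f clinear_id_const] braid23_pure[OF F])
qed

section \<open>The braid relation on U(g)\<close>

lemma braiding_uea_braiding: "braiding (uea_braiding :: 'g::complex_lie_algebra uea \<otimes> 'g uea \<Rightarrow> _)"
proof -
  let ?P = "uea_braiding :: 'g uea \<otimes> 'g uea \<Rightarrow> _"
  let ?L = "\<lambda>t. braid23 ?P (braid12 ?P (braid23 ?P t))"
  let ?R = "\<lambda>t. braid12 ?P (braid23 ?P (braid12 ?P t))"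
  note lin = clinear_uea_braiding
  note c12 = clinear_braid12[OF lin] and c23 = clinear_braid23[OF lin]
  have L: "clinear ?L" and R: "clinear ?R"
    by (rule clinear_compose[OF c23 clinear_compose[OF c12 c23]]
        clinear_compose[OF c12 clinear_compose[OF c23 c12]])+

  \<comment> \<open>The index is the tensor factor acted on; A stands for the adjoint action and L
    for left multiplication.\<close>
  define A1 where "A1 x = braid12 (tensor_map (uea_ad x) id)" for x :: 'g
  define A2 where "A2 x = braid12 (tensor_map id (uea_ad x))" for x :: 'g
  define L1 where "L1 x = braid12 (tensor_map ((*) (uea_of x)) id)" for x :: 'g
  define L2 where "L2 x = braid12 (tensor_map id ((*) (uea_of x)))" for x :: 'g
  define L3 where "L3 x = braid23 (tensor_map id ((*) (uea_of x)))" for x :: 'g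
  have lins: "clinear (tensor_map (uea_ad x) id :: 'g uea \<otimes> 'g uea \<Rightarrow> _)"
    "clinear (tensor_map id (uea_ad x) :: 'g uea \<otimes> 'g uea \<Rightarrow> _)"
    "clinear (tensor_map ((*) (uea_of x)) id :: 'g uea \<otimes> 'g uea \<Rightarrow> _)"
    "clinear (tensor_map id ((*) (uea_of x)) :: 'g uea \<otimes> 'g uea \<Rightarrow> _)" for x :: 'g
    by (intro clinear_tensor_map clinear_uea_ad clinear_mult_left clinear_id_const)+

  have ad_mult_12: "braid12 (ad_mult x) t = A1 x t + L2 x t"
    and ad_mult_23: "braid23 (ad_mult x) t = A2 x t + L3 x t"
    and ad_ad_12: "braid12 (ad_ad x) t = A1 x t + A2 x t" for x t
    unfolding ad_mult_def[abs_def] ad_ad_def[abs_def] A1_def A2_def L2_def L3_def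
      braid12_second_eq_braid23_first[OF clinear_uea_ad]
    by (rule braid12_plus[OF lins(1,4)] braid23_plus[OF lins(1,4)]
        braid12_plus[OF lins(1,2), unfolded braid12_second_eq_braid23_first[OF clinear_uea_ad]])+

  have L1_12: "braid12 ?P (L1 x t) = A1 x (braid12 ?P t) + L2 x (braid12 ?P t)" for x t
    unfolding L1_def ad_mult_12[symmetric]
    by (rule braid12_intertwine[OF lin lins(3) clinear_ad_mult lin uea_braiding_mult_left])
  have L2_23: "braid23 ?P (L2 x t) = A2 x (braid23 ?P t) + L3 x (braid23 ?P t)" for x t
    unfolding L2_def ad_mult_23[symmetric] braid12_second_eq_braid23_first[OF clinear_mult_left]
    by (rule braid23_intertwine[OF lin lins(3) clinear_ad_mult lin uea_braiding_mult_left])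
  \<comment> \<open>\<open>uea_braiding_ad_ad\<close> controls only the sum of \<open>A1 x\<close>
    and \<open>A2 x\<close>, so the two terms are kept together.\<close>
  have A_12: "braid12 ?P (A1 x t) + braid12 ?P (A2 x t) = A1 x (braid12 ?P t) + A2 x (braid12 ?P t)"
    for x t
    unfolding ad_ad_12[symmetric] clinear_add[OF c12, symmetric]
    by (rule braid12_intertwine[OF lin clinear_ad_ad clinear_ad_ad lin uea_braiding_ad_ad])
  have L3_12: "braid12 ?P (L3 x t) = L3 x (braid12 ?P t)" for x t
    unfolding L3_def by (rule braid12_third_commute[OF lin clinear_mult_left])
  have A1_23: "braid23 ?P (A1 x t) = A1 x (braid23 ?P t)"
    and L1_23: "braid23 ?P (L1 x t) = L1 x (braid23 ?P t)" for x t
    unfolding A1_def L1_def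
    by (rule braid23_first_commute[OF lin clinear_uea_ad]
        braid23_first_commute[OF lin clinear_mult_left])+

  \<comment> \<open>\<open>L1\<close> passes the inner \<open>braid23\<close> and becomes A1 + L2 at
    \<open>braid12\<close>; at the outer \<open>braid23\<close>, \<open>A1\<close> passes and
    \<open>L2\<close> becomes A2 + L3.\<close>
  have L_L1: "?L (L1 x t) = A1 x (?L t) + A2 x (?L t) + L3 x (?L t)" for x t
    by (simp only: L1_23 L1_12 clinear_add[OF c23] A1_23 L2_23 add.assoc)
  \<comment> \<open>Here \<open>L1\<close> becomes A1 + L2 at the inner \<open>braid12\<close>, then
    A1 + A2 + L3 at \<open>braid23\<close>. The outer \<open>braid12\<close> commutes with the sum
    A1 + A2 and with \<open>L3\<close>.\<close>
  have R_L1: "?R (L1 x t) = A1 x (?R t) + A2 x (?R t) + L3 x (?R t)" for x t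
    by (simp only: L1_12 clinear_add[OF c23] clinear_add[OF c12] A1_23 L2_23 L3_12 A_12
        add.assoc[symmetric])

  have "?L ((a \<otimes> b) \<otimes> c) = ?R ((a \<otimes> b) \<otimes> c)" for a b c
  proof (rule clinear_uea_eqI[where u = a])
    show "clinear (\<lambda>a. ?L ((a \<otimes> b) \<otimes> c))" "clinear (\<lambda>a. ?R ((a \<otimes> b) \<otimes> c))"
      by (rule clinear_compose[OF L clinear_compose[OF clinear_pure_left clinear_pure_left]]
          clinear_compose[OF R clinear_compose[OF clinear_pure_left clinear_pure_left]])+
    \<comment> \<open>Moving 1 to the right past two factors leaves them unchanged. With
      \<open>s\<close> the braiding of \<open>b \<otimes> c\<close>, both sides of the braid
      relation at \<open>a = 1\<close> become \<open>s \<otimes> 1\<close>.\<close>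
    have "braid23 ?P (braid12 ?P (tensor_assoc_inv (1 \<otimes> s))) = s \<otimes> 1" for s
      by (rule clinear_tensor_eqI[where t = s, OF clinear_compose[OF c23 clinear_compose[OF c12
              clinear_compose[OF clinear_tensor_assoc_inv clinear_pure_right]]] clinear_pure_left])
        (simp add: tensor_assoc_inv_pure braid12_pure[OF lin] braid23_pure[OF lin] uea_braiding_one)
    then show "?L ((1 \<otimes> b) \<otimes> c) = ?R ((1 \<otimes> b) \<otimes> c)"
      by (simp add: braid23_pure[OF lin] braid12_pure[OF lin] uea_braiding_one tensor_assoc_inv_pure)
    fix x a
    assume "?L ((a \<otimes> b) \<otimes> c) = ?R ((a \<otimes> b) \<otimes> c)"
    moreover have "((uea_of x * a) \<otimes> b) \<otimes> c = L1 x ((a \<otimes> b) \<otimes> c)"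
      by (simp add: L1_def braid12_pure[OF lins(3)] tensor_map_pure[OF clinear_mult_left clinear_id_const])
    ultimately show "?L (((uea_of x * a) \<otimes> b) \<otimes> c) = ?R (((uea_of x * a) \<otimes> b) \<otimes> c)"
      by (simp only: L_L1 R_L1)
  qed
  then have "?L t = ?R t" for t
    by (rule clinear_triple_tensor_eqI[OF L R])
  then show ?thesis
    by (simp add: braiding_def lin fun_eq_iff)
qed

section \<open>Compatibility with the braiding on V\<close>

lemma clinear_V_incl: "clinear V_incl"
  by (rule clinearI) (simp_all add: V_incl_def scaleC_prod_def scaleC_complex_def
      clinear_add[OF clinear_uea_of] clinear_scaleC[OF clinear_uea_of] scaleC_add_left
      scaleC_add_right scaleC_scaleC)

lemma uea_braiding_extends_lie_braiding:
  "uea_braiding (tensor_map V_incl V_incl t) = tensor_map V_incl V_incl (lie_braiding t)"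
proof -
  note inc = clinear_tensor_map[OF clinear_V_incl clinear_V_incl]
  have incl: "V_incl V_one = (1 :: 'a uea)" "V_incl (V_of x) = uea_of x" for x :: 'a
    by (simp_all add: V_incl_def V_one_def V_of_def scaleC_one clinear_zero[OF clinear_uea_of])
  have ad: "uea_ad (snd u) (V_incl v) = uea_of (bracket (snd u) (snd v))" for u v :: "complex \<times> 'a"
    by (simp add: V_incl_def clinear_add[OF clinear_uea_ad] clinear_scaleC[OF clinear_uea_ad]
        uea_ad_one uea_ad_uea_of)
  \<comment> \<open>Only \<open>u\<close> is split: its scalar part is flipped past
    \<open>V_incl v\<close>, and its Lie part adds an adjoint term. By \<open>ad\<close> that term
    sees only the Lie part of \<open>v\<close>, as the adjoint action kills 1.\<close>
  have "uea_braiding (V_incl u \<otimes> V_incl v)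
      = V_incl v \<otimes> V_incl u + uea_of (bracket (snd u) (snd v)) \<otimes> 1" for u v :: "complex \<times> 'a"
    unfolding V_incl_def[of u]
    by (simp add: tensor_linear_simps clinear_add[OF clinear_uea_braiding]
        clinear_scaleC[OF clinear_uea_braiding] uea_braiding_one uea_braiding_uea_of ad algebra_simps)
  then have "uea_braiding (tensor_map V_incl V_incl (u \<otimes> v))
      = tensor_map V_incl V_incl (lie_braiding (u \<otimes> v))" for u v :: "complex \<times> 'a"
    by (simp add: tensor_map_pure[OF clinear_V_incl clinear_V_incl] lie_braiding_pure
        clinear_add[OF inc] incl)
  then show ?thesis
    by (rule clinear_tensor_eqI[OF clinear_compose[OF clinear_uea_braiding inc]
          clinear_compose[OF inc clinear_lie_braiding]])
qed

theorem proposition2p2: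
  fixes \<psi> :: "(complex \<times> 'g::complex_lie_algebra) \<otimes> (complex \<times> 'g)
      \<Rightarrow> (complex \<times> 'g) \<otimes> (complex \<times> 'g)"
  assumes "braiding \<psi>"
    and "\<psi> (V_one \<otimes> V_one) = V_one \<otimes> V_one"
    and "\<And>\<xi>. \<psi> (V_one \<otimes> V_of \<xi>) = V_of \<xi> \<otimes> V_one"
    and "\<And>\<xi>. \<psi> (V_of \<xi> \<otimes> V_one) = V_one \<otimes> V_of \<xi>"
    and "\<And>\<xi> \<eta>. \<psi> (V_of \<xi> \<otimes> V_of \<eta>)
      = V_of \<eta> \<otimes> V_of \<xi> + V_of (bracket \<xi> \<eta>) \<otimes> V_one"
  shows "\<exists>\<Psi> :: 'g uea \<otimes> 'g uea \<Rightarrow> 'g uea \<otimes> 'g uea.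
    braiding \<Psi>
    \<and> \<Psi> \<circ> tensor_map V_incl V_incl = tensor_map V_incl V_incl \<circ> \<psi>
    \<and> algebra_mult \<circ> \<Psi> = algebra_mult"
proof (intro exI conjI)
  have snd: "snd (V_of \<xi>) = \<xi>" "snd V_one = (0::'g)" "V_of (0::'g) = 0" for \<xi> :: 'g
    by (simp_all add: V_of_def V_one_def zero_prod_def)
  \<comment> \<open>The assumptions on \<open>\<psi>\<close> are the conditions in
    \<open>lie_braiding_unique\<close>, which \<open>lie_braiding\<close> satisfies as well; both
    maps therefore equal the unique solution.\<close>
  have "\<psi> = lie_braiding"
    by (rule trans[OF the1_equality[OF lie_braiding_unique, symmetric] the1_equality[OF lie_braiding_unique]])
      (simp_all add: assms braiding_lie_braiding lie_braiding_pure snd bracket_zero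
        clinear_zero[OF clinear_pure_left])
  then show "uea_braiding \<circ> tensor_map V_incl V_incl = tensor_map V_incl V_incl \<circ> \<psi>"
    by (simp add: fun_eq_iff uea_braiding_extends_lie_braiding)
  show "braiding (uea_braiding :: 'g uea \<otimes> 'g uea \<Rightarrow> _)"
    by (rule braiding_uea_braiding)
  show "algebra_mult \<circ> uea_braiding = (algebra_mult :: 'g uea \<otimes> 'g uea \<Rightarrow> _)"
    by (simp add: fun_eq_iff algebra_mult_uea_braiding)
qed

end
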